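(* Let $G$ be a graph such that its independence complex $I(G)$ is a near-cone. Then $G$ is obtained from some graph $G_0$ (possibly with empty vertex set) by a finite sequence of $D$ and $S$ operations, including at least one $D$ operation.
   Context: Graphs are finite and simple. The independence complex $I(G)$ is the simplicial complex on vertex set $V(G)$ whose faces are the independent sets of $G$. A simplicial complex $\Delta$ is a near-cone (with respect to an apex vertex $v\in V(\Delta)$) if for every face $\sigma$ and every $w\in\sigma$, the set $(\sigma\setminus\{w\})\cup\{v\}$ is also a face. For a graph $G$, $D(G)$ is the disjoint union of $G$ with a new isolated vertex $v$. $S(G)$ is the graph on vertex set $V(G)\cup\{v\}$, for a new vertex $v$, with edge set $E(G)\cup\{wv : w\in V(G)\}$. *)

theory Defs
  imports "Graph_Theory.Pair_Digraph"
begin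

text \<open>
  A finite simple graph is a \<^locale>\<open>pair_graph\<close>: finite vertex set and a symmetric, loop-free
  arc relation on it, so an undirected edge \<open>uw\<close> is the pair of arcs \<open>(u, w)\<close>, \<open>(w, u)\<close>.
  The empty vertex set is allowed.
\<close>

section \<open>Simplicial complexes and near-cones\<close>

text \<open>
  A finite abstract simplicial complex is given by its set of faces; its vertices are the elements
  of its faces.
\<close>

definition abstract_simplicial_complex :: "'a set set \<Rightarrow> bool" where
  "abstract_simplicial_complex \<Delta> \<longleftrightarrow>
     finite (\<Union>\<Delta>) \<and> {} \<in> \<Delta> \<and> (\<forall>\<sigma>\<in>\<Delta>. \<forall>\<tau>. \<tau> \<subseteq> \<sigma> \<longrightarrow> \<tau> \<in> \<Delta>)"

definition near_cone_wrt :: "'a set set \<Rightarrow> 'a \<Rightarrow> bool" where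
  "near_cone_wrt \<Delta> v \<longleftrightarrow>
     v \<in> \<Union>\<Delta> \<and> (\<forall>\<sigma>\<in>\<Delta>. \<forall>w\<in>\<sigma>. (\<sigma> - {w}) \<union> {v} \<in> \<Delta>)"

definition near_cone :: "'a set set \<Rightarrow> bool" where
  "near_cone \<Delta> \<longleftrightarrow> abstract_simplicial_complex \<Delta> \<and> (\<exists>v. near_cone_wrt \<Delta> v)"

section \<open>The independence complex\<close>

definition independent_set :: "'a pair_pre_digraph \<Rightarrow> 'a set \<Rightarrow> bool" where
  "independent_set G \<sigma> \<longleftrightarrow> \<sigma> \<subseteq> pverts G \<and> (\<forall>u\<in>\<sigma>. \<forall>w\<in>\<sigma>. (u, w) \<notin> parcs G)"

definition independence_complex :: "'a pair_pre_digraph \<Rightarrow> 'a set set" where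
  "independence_complex G = {\<sigma>. independent_set G \<sigma>}"

lemma Union_independence_complex:
  assumes "pair_graph G"
  shows "\<Union>(independence_complex G) = pverts G"
proof -
  interpret pair_graph G by fact
  have "{v} \<in> independence_complex G" if "v \<in> pverts G" for v
  proof -
    have "(v, v) \<notin> parcs G"
      using pair_no_loops by fastforce
    with that show ?thesis
      by (simp add: independence_complex_def independent_set_def)
  qed
  then have "pverts G \<subseteq> \<Union>(independence_complex G)"
    by blast
  moreover have "\<Union>(independence_complex G) \<subseteq> pverts G"
    by (auto simp: independence_complex_def independent_set_def)
  ultimately show ?thesis
    by blast
qed

lemma abstract_simplicial_complex_independence_complex:
  assumes "pair_graph G"
  shows "abstract_simplicial_complex (independence_complex G)"
proof -
  interpret pair_graph G by fact
  show ?thesis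
    unfolding abstract_simplicial_complex_def Union_independence_complex[OF assms]
    using pair_finite_verts
    unfolding independence_complex_def independent_set_def by blast
qed

section \<open>The operations D and S\<close>

text \<open>The new vertex \<open>v\<close> is a parameter; it is required not to lie in \<open>G\<close> wherever these are used.\<close>

definition graph_D :: "'a \<Rightarrow> 'a pair_pre_digraph \<Rightarrow> 'a pair_pre_digraph" where
  "graph_D v G = \<lparr> pverts = pverts G \<union> {v}, parcs = parcs G \<rparr>"

definition graph_S :: "'a \<Rightarrow> 'a pair_pre_digraph \<Rightarrow> 'a pair_pre_digraph" where
  "graph_S v G = \<lparr> pverts = pverts G \<union> {v},
     parcs = parcs G \<union> {(w, v) | w. w \<in> pverts G} \<union> {(v, w) | w. w \<in> pverts G} \<rparr>"

lemma pair_graph_graph_D: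
  assumes "pair_graph G"
  shows "pair_graph (graph_D v G)"
proof -
  interpret pair_graph G by fact
  have "sym (parcs G)"
    using pair_sym_arcs by (simp add: symmetric_def)
  then show ?thesis
    by unfold_locales
      (simp_all add: graph_D_def symmetric_def arc_fst_in_verts arc_snd_in_verts
        pair_finite_verts pair_finite_arcs pair_no_loops)
qed

lemma pair_graph_graph_S:
  assumes "pair_graph G" and "v \<notin> pverts G"
  shows "pair_graph (graph_S v G)"
proof -
  interpret pair_graph G by fact
  have "sym (parcs G)"
    using pair_sym_arcs by (simp add: symmetric_def)
  then have "sym (parcs (graph_S v G))"
    unfolding sym_def graph_S_def by simp
  then show ?thesis
    using pair_finite_verts pair_finite_arcs pair_no_loops assms(2)
    by unfold_locales (auto simp: graph_S_def symmetric_def wellformed')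
qed

datatype graph_op = Op_D | Op_S

text \<open>
  \<open>obtained_from G0 ops G\<close>: \<open>G\<close> arises from \<open>G0\<close> by performing the operations \<open>ops\<close> from left to
  right, each with a vertex that is new at that moment.
\<close>

inductive obtained_from ::
  "'a pair_pre_digraph \<Rightarrow> graph_op list \<Rightarrow> 'a pair_pre_digraph \<Rightarrow> bool" for G0 where
  start: "obtained_from G0 [] G0"
| step_D: "obtained_from G0 ops G \<Longrightarrow> v \<notin> pverts G \<Longrightarrow> obtained_from G0 (ops @ [Op_D]) (graph_D v G)"
| step_S: "obtained_from G0 ops G \<Longrightarrow> v \<notin> pverts G \<Longrightarrow> obtained_from G0 (ops @ [Op_S]) (graph_S v G)"

end

theory Submission
  imports Defs
begin

text \<open>
  Let \<open>v\<close> be an apex and \<open>u\<close> a neighbour of \<open>v\<close>. If \<open>w \<noteq> u\<close> were not adjacent to \<open>u\<close>, then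
  exchanging \<open>w\<close> for \<open>v\<close> in the face \<open>{u, w}\<close> would make \<open>{u, v}\<close> a face. Hence every neighbour of
  \<open>v\<close> is adjacent to all other vertices and can be removed by undoing an \<open>S\<close> operation; once \<open>v\<close>
  has no neighbours left, removing \<open>v\<close> itself undoes a \<open>D\<close> operation.
\<close>

definition remove_vertex :: "'a \<Rightarrow> 'a pair_pre_digraph \<Rightarrow> 'a pair_pre_digraph" where
  "remove_vertex u G = \<lparr> pverts = pverts G - {u}, parcs = {(x, y) \<in> parcs G. x \<noteq> u \<and> y \<noteq> u} \<rparr>"

lemma pverts_remove_vertex [simp]: "pverts (remove_vertex u G) = pverts G - {u}"
  by (simp add: remove_vertex_def)

lemma parcs_remove_vertex_iff [simp]:
  "(x, y) \<in> parcs (remove_vertex u G) \<longleftrightarrow> (x, y) \<in> parcs G \<and> x \<noteq> u \<and> y \<noteq> u"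
  by (simp add: remove_vertex_def)

lemma pair_graph_arc_sym:
  assumes "pair_graph G" and "(x, y) \<in> parcs G"
  shows "(y, x) \<in> parcs G"
proof -
  interpret pair_graph G by fact
  show ?thesis
    using pair_sym_arcs assms(2) by (simp add: symmetric_def sym_def)
qed

lemma pair_graph_no_loop:
  assumes "pair_graph G"
  shows "(x, x) \<notin> parcs G"
proof -
  interpret pair_graph G by fact
  show ?thesis
    using pair_no_loops by fastforce
qed

lemma pair_graph_arc_in_verts:
  assumes "pair_graph G" and "(x, y) \<in> parcs G"
  shows "x \<in> pverts G" and "y \<in> pverts G"
proof -
  interpret pair_graph G by fact
  show "x \<in> pverts G" and "y \<in> pverts G"
    using wellformed' assms(2) by auto
qed

lemma pair_graph_remove_vertex:
  assumes "pair_graph G"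
  shows "pair_graph (remove_vertex u G)"
proof -
  interpret pair_graph G by fact
  have "parcs (remove_vertex u G) \<subseteq> parcs G"
    by auto
  then have "finite (parcs (remove_vertex u G))"
    using pair_finite_arcs finite_subset by blast
  moreover have "sym (parcs (remove_vertex u G))"
    using pair_graph_arc_sym[OF assms] unfolding sym_def parcs_remove_vertex_iff by blast
  ultimately show ?thesis
    using pair_finite_verts pair_graph_no_loop[OF assms] pair_graph_arc_in_verts[OF assms]
    by unfold_locales (auto simp: symmetric_def)
qed

text \<open>By symmetry and loop-freeness, the arcs at a universal vertex \<open>u\<close> are
  exactly both orientations of the edges from \<open>u\<close> to every other vertex. These are the
  arcs that deletion loses and \<open>graph_S\<close> restores.\<close>

lemma graph_S_remove_vertex:
  assumes "pair_graph G" and "u \<in> pverts G"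
    and "\<forall>w\<in>pverts G - {u}. (u, w) \<in> parcs G"
  shows "graph_S u (remove_vertex u G) = G"
proof (rule pair_pre_digraph.equality)
  show "parcs (graph_S u (remove_vertex u G)) = parcs G"
  proof (rule set_eqI, clarify)
    fix x y
    have "(x, y) \<in> parcs (graph_S u (remove_vertex u G)) \<longleftrightarrow>
        (x, y) \<in> parcs G \<and> x \<noteq> u \<and> y \<noteq> u \<or>
        y = u \<and> x \<in> pverts G - {u} \<or> x = u \<and> y \<in> pverts G - {u}"
      by (auto simp: graph_S_def)
    also have "\<dots> \<longleftrightarrow> (x, y) \<in> parcs G"
      using assms(3) pair_graph_arc_sym[OF assms(1)] pair_graph_no_loop[OF assms(1)]
        pair_graph_arc_in_verts[OF assms(1)]
      by blast
    finally show "(x, y) \<in> parcs (graph_S u (remove_vertex u G)) \<longleftrightarrow> (x, y) \<in> parcs G" .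
  qed
qed (use assms(2) in \<open>auto simp: graph_S_def\<close>)

lemma graph_D_remove_vertex:
  assumes "pair_graph G" and "v \<in> pverts G" and "\<forall>u. (v, u) \<notin> parcs G"
  shows "graph_D v (remove_vertex v G) = G"
proof (rule pair_pre_digraph.equality)
  show "parcs (graph_D v (remove_vertex v G)) = parcs G"
  proof -
    \<comment> \<open>With no arc entering or leaving \<open>v\<close>, the deletion loses no arc,
      so only the vertex has to be put back.\<close>
    have "\<forall>u. (u, v) \<notin> parcs G"
      using assms(3) pair_graph_arc_sym[OF assms(1)] by blast
    with assms(3) show ?thesis
      by (auto simp: graph_D_def)
  qed
qed (use assms(2) in \<open>auto simp: graph_D_def\<close>)

lemma near_cone_wrt_neighbour_universal:
  assumes "pair_graph G" and near: "near_cone_wrt (independence_complex G) v"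
    and vu: "(v, u) \<in> parcs G" and w: "w \<in> pverts G - {u}"
  shows "(u, w) \<in> parcs G"
proof (rule ccontr)
  assume "(u, w) \<notin> parcs G"
  moreover from this have "(w, u) \<notin> parcs G"
    using pair_graph_arc_sym[OF assms(1)] by blast
  ultimately have "{u, w} \<in> independence_complex G"
    using w pair_graph_arc_in_verts[OF assms(1) vu] pair_graph_no_loop[OF assms(1)]
    by (auto simp: independence_complex_def independent_set_def)
  \<comment> \<open>As \<open>w\<close> differs from \<open>u\<close>, this face is
    \<open>{u, v}\<close>, which contains the arc \<open>(v, u)\<close>. The argument also covers
    \<open>w = v\<close>.\<close>
  then have "({u, w} - {w}) \<union> {v} \<in> independence_complex G"
    using near by (simp add: near_cone_wrt_def)
  then show False
    using vu w by (auto simp: independence_complex_def independent_set_def)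
qed

text \<open>Deleting \<open>u\<close> keeps exactly the faces that avoid \<open>u\<close>, and an
  exchange inserts only \<open>v\<close>, which is not \<open>u\<close>.\<close>

lemma near_cone_wrt_remove_vertex:
  assumes "near_cone_wrt (independence_complex G) v" and "u \<noteq> v"
  shows "near_cone_wrt (independence_complex (remove_vertex u G)) v"
proof -
  have faces: "\<sigma> \<in> independence_complex (remove_vertex u G) \<longleftrightarrow>
      \<sigma> \<in> independence_complex G \<and> u \<notin> \<sigma>" for \<sigma>
    by (auto simp: independence_complex_def independent_set_def)
  \<comment> \<open>A face containing \<open>v\<close> shows that \<open>v\<close> is a vertex
    without a loop, so \<open>{v}\<close> is a face and survives the deletion.\<close>
  obtain \<sigma> where "\<sigma> \<in> independence_complex G" and "v \<in> \<sigma>"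
    using assms(1) by (auto simp: near_cone_wrt_def)
  then have "{v} \<in> independence_complex (remove_vertex u G)"
    using assms(2) by (auto simp: independence_complex_def independent_set_def)
  then have "v \<in> \<Union>(independence_complex (remove_vertex u G))"
    by blast
  moreover have "(\<sigma> - {w}) \<union> {v} \<in> independence_complex (remove_vertex u G)"
    if "\<sigma> \<in> independence_complex (remove_vertex u G)" and "w \<in> \<sigma>" for \<sigma> w
    using that assms by (simp add: faces near_cone_wrt_def)
  ultimately show ?thesis
    by (simp add: near_cone_wrt_def)
qed

text \<open>Induction on the number of vertices with the apex \<open>v\<close> fixed. The list built
  is one \<open>Op_D\<close>, which adds \<open>v\<close>, followed by one \<open>Op_S\<close> for
  each neighbour of \<open>v\<close>.\<close>

lemma near_cone_wrt_obtained_from: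
  assumes "pair_graph G" and "near_cone_wrt (independence_complex G) v"
  shows "\<exists>G0 ops. pair_graph G0 \<and> obtained_from G0 ops G \<and> Op_D \<in> set ops"
  using assms
proof (induction "card (pverts G)" arbitrary: G rule: less_induct)
  case less
  have v: "v \<in> pverts G"
    using less.prems by (simp add: near_cone_wrt_def Union_independence_complex)
  show ?case
  proof (cases "\<exists>u. (v, u) \<in> parcs G")
    case True
    then obtain u where vu: "(v, u) \<in> parcs G" ..
    let ?H = "remove_vertex u G"
    have u: "u \<in> pverts G" and "u \<noteq> v"
      using vu pair_graph_arc_in_verts[OF less.prems(1)] pair_graph_no_loop[OF less.prems(1)]
      by auto
    interpret pair_graph G by (fact less.prems(1))
    have "card (pverts ?H) < card (pverts G)"
      unfolding pverts_remove_vertex using pair_finite_verts u by (rule card_Diff1_less)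
    then obtain G0 ops where "pair_graph G0" "obtained_from G0 ops ?H" "Op_D \<in> set ops"
      using less.hyps pair_graph_remove_vertex[OF less.prems(1)]
        near_cone_wrt_remove_vertex[OF less.prems(2) \<open>u \<noteq> v\<close>] by blast
    \<comment> \<open>The neighbour \<open>u\<close> is the vertex added last, so its
      \<open>Op_S\<close> goes at the end of the list given by induction.\<close>
    moreover have "graph_S u ?H = G"
      using near_cone_wrt_neighbour_universal[OF less.prems vu] u
      by (intro graph_S_remove_vertex[OF less.prems(1)]) auto
    ultimately have "pair_graph G0 \<and> obtained_from G0 (ops @ [Op_S]) G \<and>
        Op_D \<in> set (ops @ [Op_S])"
      using step_S[of G0 ops ?H u] by simp
    then show ?thesis
      by blast
  next
    case False
    \<comment> \<open>Here \<open>v\<close> is isolated. What remains without it need not be a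
      near-cone and may be empty; it serves as \<open>G0\<close>.\<close>
    then have "graph_D v (remove_vertex v G) = G"
      using graph_D_remove_vertex[OF less.prems(1) v] by blast
    then have "obtained_from (remove_vertex v G) [Op_D] G"
      using step_D[OF start, of v "remove_vertex v G"] by simp
    then show ?thesis
      using pair_graph_remove_vertex[OF less.prems(1)] by fastforce
  qed
qed

theorem proposition2p15:
  fixes G :: "'a pair_pre_digraph"
  assumes "pair_graph G"
    and "near_cone (independence_complex G)"
  shows "\<exists>G0 ops. pair_graph G0 \<and> obtained_from G0 ops G \<and> Op_D \<in> set ops"
  using assms near_cone_wrt_obtained_from by (auto simp: near_cone_def)

end
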